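(* There exist absolute constants $c,C>0$ such that for every four cycle-free Boolean matrix $M$ of degeneracy $d$, $$c\sqrt{d}\le \gamma_2(M)\le C\sqrt{d}.$$
   Context: A Boolean matrix is a matrix with entries in $\{0,1\}$. A submatrix is obtained by choosing an arbitrary subset of the rows and an arbitrary subset of the columns. A Boolean matrix is four cycle-free if it contains no $2\times 2$ all-ones submatrix. The degeneracy of a Boolean matrix $M$ is the smallest nonnegative integer $d$ such that every submatrix of $M$ has a row or a column with at most $d$ one entries. For a real matrix $M$, $\gamma_2(M)=\min_{UV=M}\|U\|_{\mathrm{row}}\|V\|_{\mathrm{col}}$, where the minimum is over all factorizations $M=UV$ into real matrices, $\|U\|_{\mathrm{row}}$ is the maximum $\ell_2$-norm of a row of $U$, and $\|V\|_{\mathrm{col}}$ is the maximum $\ell_2$-norm of a column of $V$. *)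

theory Defs
  imports "HOL-Analysis.L2_Norm" "Jordan_Normal_Form.DL_Submatrix"
begin

definition boolean_mat :: "real mat \<Rightarrow> bool" where
  "boolean_mat M \<longleftrightarrow> elements_mat M \<subseteq> {0, 1}"

definition four_cycle_free :: "real mat \<Rightarrow> bool" where
  "four_cycle_free M \<longleftrightarrow> \<not> (\<exists>I J. submatrix M I J = mat 2 2 (\<lambda>_. 1))"

definition row_ones :: "real mat \<Rightarrow> nat \<Rightarrow> nat" where
  "row_ones M i = card {j. j < dim_col M \<and> M $$ (i, j) = 1}"

definition col_ones :: "real mat \<Rightarrow> nat \<Rightarrow> nat" where
  "col_ones M j = card {i. i < dim_row M \<and> M $$ (i, j) = 1}"

(* Submatrices without rows or without columns are left out: the one with neither has no
   row or column at all, and the others satisfy the condition trivially. *)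
definition degenerate :: "nat \<Rightarrow> real mat \<Rightarrow> bool" where
  "degenerate d M \<longleftrightarrow>
    (\<forall>I J. let N = submatrix M I J in
       dim_row N > 0 \<longrightarrow> dim_col N > 0 \<longrightarrow>
       (\<exists>i < dim_row N. row_ones N i \<le> d) \<or> (\<exists>j < dim_col N. col_ones N j \<le> d))"

definition degeneracy :: "real mat \<Rightarrow> nat" where
  "degeneracy M = (LEAST d. degenerate d M)"

(* Inserting 0 fixes the maximum over an empty set of rows or columns to be 0
   and has no effect otherwise, since norms are nonnegative. *)
definition row_norm :: "real mat \<Rightarrow> real" where
  "row_norm U = Max (insert 0 ((\<lambda>i. L2_set (\<lambda>k. U $$ (i, k)) {..<dim_col U}) ` {..<dim_row U}))"

definition col_norm :: "real mat \<Rightarrow> real" where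
  "col_norm V = Max (insert 0 ((\<lambda>j. L2_set (\<lambda>k. V $$ (k, j)) {..<dim_row V}) ` {..<dim_col V}))"

(* The inner dimension of a factorization is arbitrary. *)
definition factorization_values :: "real mat \<Rightarrow> real set" where
  "factorization_values M =
    {row_norm U * col_norm V | U V. dim_col U = dim_row V \<and> U * V = M}"

(* The minimum is rendered as the infimum of a nonempty set of nonnegative reals
   (see the two lemmas below); it is attained, by compactness, hence is the minimum. *)
definition gamma2 :: "real mat \<Rightarrow> real" where
  "gamma2 M = Inf (factorization_values M)"

lemma factorization_values_nonempty: "factorization_values M \<noteq> {}"
proof -
  have "1\<^sub>m (dim_row M) * M = M"
    by (intro left_mult_one_mat) auto
  then have "row_norm (1\<^sub>m (dim_row M)) * col_norm M \<in> factorization_values M"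
    unfolding factorization_values_def
    by (intro CollectI exI[of _ "1\<^sub>m (dim_row M)"] exI[of _ M]) simp
  then show ?thesis by blast
qed

lemma factorization_values_nonneg: "x \<in> factorization_values M \<Longrightarrow> 0 \<le> x"
  unfolding factorization_values_def row_norm_def col_norm_def
  by (auto intro!: mult_nonneg_nonneg Max_ge)

end

theory Submission
  imports Defs "HOL-Analysis.Convex"
begin

text \<open>
  Upper bound: repeatedly deleting a row or column with at most \<open>d\<close> ones and charging these ones to
  it splits \<open>M = A + B\<close>, where the rows of \<open>A\<close> and the columns of \<open>B\<close> have at most \<open>d\<close> ones. Then
  \<open>M = A I + I B\<close>, suitably rescaled, is a factorization of value \<open>2 \<surd>d\<close>.

  Lower bound: some submatrix has all row and column degrees at least \<open>d\<close>, and by the same charging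
  argument its average degrees are \<open>O(d)\<close> on the larger side, say the rows. Discarding heavy rows and
  light columns leaves \<open>m\<close> rows, each of degree at most \<open>4 d\<close>, columns of degrees \<open>c j \<ge> d / 4\<close>, and
  at least \<open>d m / 2\<close> ones. The column degrees may be arbitrarily unbalanced, so the columns are
  normalized: let \<open>Y i j = M i j / (6 \<surd>(c j))\<close>. As there is no four-cycle, \<open>G = Y\<^sup>T Y\<close> is close to a
  multiple of the identity in the weak sense that the diagonal of \<open>G\<^sup>2\<close> is at most half that of \<open>G\<close>.
  Hence \<open>W = Y (1 + G)\<^sup>-\<^sup>1\<close>, which has operator norm at most \<open>1/2\<close>, correlates well with \<open>M\<close>, and
  testing a factorization of \<open>M\<close> against \<open>W\<close> with column weights \<open>\<surd>(c j)\<close> bounds its value from below.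
\<close>

section \<open>Regularized Gram systems\<close>

text \<open>Pair \<open>(1 + G) w = b\<close>, where \<open>G = Y\<^sup>T Y\<close>, with
  \<open>w\<close>: the quadratic form of \<open>G\<close> at \<open>w\<close> is the squared norm
  of \<open>Y w\<close>. Positivity in the next three lemmas comes from this identity.\<close>

lemma regularized_gram_energy:
  fixes Y :: "'i \<Rightarrow> 'j \<Rightarrow> real"
  assumes w: "\<And>j. j \<in> J \<Longrightarrow> w j + (\<Sum>i\<in>I. Y i j * (\<Sum>k\<in>J. Y i k * w k)) = b j"
  shows "(\<Sum>j\<in>J. b j * w j) = (\<Sum>j\<in>J. (w j)\<^sup>2) + (\<Sum>i\<in>I. (\<Sum>k\<in>J. Y i k * w k)\<^sup>2)"
proof -
  have "(\<Sum>j\<in>J. b j * w j) = (\<Sum>j\<in>J. (w j + (\<Sum>i\<in>I. Y i j * (\<Sum>k\<in>J. Y i k * w k))) * w j)"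
    by (intro sum.cong) (simp_all add: w)
  also have "\<dots> = (\<Sum>j\<in>J. (w j)\<^sup>2) + (\<Sum>j\<in>J. \<Sum>i\<in>I. (\<Sum>k\<in>J. Y i k * w k) * (Y i j * w j))"
    by (simp add: algebra_simps sum.distrib power2_eq_square sum_distrib_left)
  also have "(\<Sum>j\<in>J. \<Sum>i\<in>I. (\<Sum>k\<in>J. Y i k * w k) * (Y i j * w j)) =
      (\<Sum>i\<in>I. (\<Sum>k\<in>J. Y i k * w k)\<^sup>2)"
    by (subst sum.swap) (simp add: power2_eq_square sum_distrib_left)
  finally show ?thesis .
qed

text \<open>A rank one update in each step, with the Sherman--Morrison formula supplying the constant \<open>c\<close>.\<close>

lemma regularized_gram_solvable:
  fixes Y :: "'i \<Rightarrow> 'j \<Rightarrow> real"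
  assumes "finite I"
  shows "\<exists>w. \<forall>j\<in>J. w j + (\<Sum>i\<in>I. Y i j * (\<Sum>k\<in>J. Y i k * w k)) = b j"
  using assms
proof (induction I arbitrary: b)
  case empty
  then show ?case by auto
next
  case (insert a I)
  obtain p where p: "\<And>j. j \<in> J \<Longrightarrow> p j + (\<Sum>i\<in>I. Y i j * (\<Sum>k\<in>J. Y i k * p k)) = b j"
    using insert.IH by blast
  obtain q where q: "\<And>j. j \<in> J \<Longrightarrow> q j + (\<Sum>i\<in>I. Y i j * (\<Sum>k\<in>J. Y i k * q k)) = Y a j"
    using insert.IH by blast
  define ip where "ip i w = (\<Sum>k\<in>J. Y i k * w k)" for i w
  define c where "c = ip a p / (1 + ip a q)"
  \<comment> \<open>Since \<open>q\<close> has right-hand side \<open>Y a\<close>, the energy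
    identity makes \<open>ip a q\<close> a sum of squares, so the denominator
    \<open>1 + ip a q\<close> is at least 1.\<close>
  have "ip a q \<ge> 0"
    using regularized_gram_energy[OF q] by (simp add: ip_def sum_nonneg)
  then have "c * (1 + ip a q) = ip a p"
    by (simp add: c_def)
  then have c: "ip a p = c + c * ip a q"
    by (simp add: distrib_left)
  have ip_lin: "ip i (\<lambda>j. p j - c * q j) = ip i p - c * ip i q" for i
    by (simp add: ip_def sum_subtractf sum_distrib_left algebra_simps)
  have "(p j - c * q j) + (\<Sum>i\<in>insert a I. Y i j * ip i (\<lambda>j. p j - c * q j)) = b j"
    if "j \<in> J" for j
  proof -
    have "(\<Sum>i\<in>I. Y i j * ip i (\<lambda>j. p j - c * q j)) =
        (\<Sum>i\<in>I. Y i j * ip i p) - c * (\<Sum>i\<in>I. Y i j * ip i q)"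
      by (simp add: ip_lin sum_subtractf sum_distrib_left right_diff_distrib mult.left_commute)
    also have "\<dots> = (b j - p j) - c * (Y a j - q j)"
      using p[OF that] q[OF that] unfolding ip_def[symmetric]
      by (metis add_diff_cancel_left')
    finally have "(\<Sum>i\<in>I. Y i j * ip i (\<lambda>j. p j - c * q j)) = (b j - p j) - c * (Y a j - q j)" .
    \<comment> \<open>The corrected solution has inner product exactly \<open>c\<close> with the new
      row, so the new term \<open>Y a j * c\<close> cancels the change \<open>- c * Y a j\<close> in
      the old equation.\<close>
    moreover have "ip a (\<lambda>j. p j - c * q j) = c"
      using c by (simp add: ip_lin)
    ultimately show ?thesis
      using insert.hyps by (simp add: right_diff_distrib mult.commute)
  qed
  then show ?case
    unfolding ip_def by (intro exI[of _ "\<lambda>j. p j - c * q j"] ballI)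
qed

text \<open>The map taking \<open>x\<close> to
  \<open>w = (1 + G)\<^sup>-\<^sup>1 Y\<^sup>T x\<close> has norm at most 1/2, because s / (1 + s^2)
  \<le> 1/2 for every singular value s of \<open>Y\<close>. Without a spectral decomposition: the
  energy of \<open>w\<close> is the inner product of \<open>x\<close> with \<open>Y w\<close>, and
  splitting the latter by the inequality of means cancels the squared norm of
  \<open>Y w\<close>.\<close>

lemma regularized_gram_contraction:
  fixes Y :: "'i \<Rightarrow> 'j \<Rightarrow> real"
  assumes w: "\<And>j. j \<in> J \<Longrightarrow>
      w j + (\<Sum>i\<in>I. Y i j * (\<Sum>k\<in>J. Y i k * w k)) = (\<Sum>i\<in>I. Y i j * x i)"
  shows "4 * (\<Sum>j\<in>J. (w j)\<^sup>2) \<le> (\<Sum>i\<in>I. (x i)\<^sup>2)"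
proof -
  let ?h = "\<lambda>i. \<Sum>k\<in>J. Y i k * w k"
  have "(\<Sum>j\<in>J. (w j)\<^sup>2) + (\<Sum>i\<in>I. (?h i)\<^sup>2) = (\<Sum>j\<in>J. \<Sum>i\<in>I. Y i j * x i * w j)"
    using regularized_gram_energy[OF w] by (simp add: sum_distrib_right)
  also have "\<dots> = (\<Sum>i\<in>I. x i * ?h i)"
    by (subst sum.swap) (simp add: sum_distrib_left mult_ac)
  also have "\<dots> \<le> (\<Sum>i\<in>I. (?h i)\<^sup>2 + (x i)\<^sup>2 / 4)"
  proof (intro sum_mono)
    fix i
    have "0 \<le> (?h i - x i / 2)\<^sup>2" by simp
    then show "x i * ?h i \<le> (?h i)\<^sup>2 + (x i)\<^sup>2 / 4"
      by (simp add: power2_eq_square algebra_simps)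
  qed
  finally show ?thesis
    by (simp add: sum.distrib flip: sum_divide_distrib)
qed

text \<open>With \<open>G = Y\<^sup>T Y\<close>, this is the diagonal part of \<open>(1 + G)\<^sup>-\<^sup>1 G \<ge> G - G\<^sup>2\<close>.\<close>

lemma regularized_gram_diagonal:
  fixes Y :: "'i \<Rightarrow> 'j \<Rightarrow> real"
  assumes w: "\<And>j. j \<in> J \<Longrightarrow>
      w j + (\<Sum>i\<in>I. Y i j * (\<Sum>k\<in>J. Y i k * w k)) = (\<Sum>i\<in>I. Y i j * Y i l)"
    and l: "l \<in> J"
  shows "(\<Sum>i\<in>I. (Y i l)\<^sup>2) - (\<Sum>j\<in>J. (\<Sum>i\<in>I. Y i j * Y i l)\<^sup>2) \<le> w l"
proof -
  define b where "b j = (\<Sum>i\<in>I. Y i j * Y i l)" for j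
  \<comment> \<open>\<open>b\<close> is column \<open>l\<close> of the symmetric matrix
    \<open>G\<close>, so entry \<open>l\<close> of \<open>G w = b - w\<close> is the inner product
    of \<open>b\<close> and \<open>w\<close>. It remains to bound this by the squared norm of
    \<open>b\<close>.\<close>
  have "b l - w l = (\<Sum>i\<in>I. Y i l * (\<Sum>k\<in>J. Y i k * w k))"
    using w[OF l] by (simp add: b_def)
  also have "\<dots> = (\<Sum>j\<in>J. b j * w j)"
    by (simp add: b_def sum_distrib_left sum_distrib_right mult_ac sum.swap[of _ I J])
  finally have bw: "b l - w l = (\<Sum>j\<in>J. b j * w j)" .
  have "(\<Sum>j\<in>J. b j * w j) \<ge> (\<Sum>j\<in>J. (w j)\<^sup>2)"
    using regularized_gram_energy[OF w] by (simp add: b_def sum_nonneg)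
  moreover have "0 \<le> (\<Sum>j\<in>J. (b j - w j)\<^sup>2)"
    by (simp add: sum_nonneg)
  moreover have "(\<Sum>j\<in>J. (b j - w j)\<^sup>2) =
      (\<Sum>j\<in>J. (b j)\<^sup>2) - 2 * (\<Sum>j\<in>J. b j * w j) + (\<Sum>j\<in>J. (w j)\<^sup>2)"
    by (simp add: power2_diff sum.distrib sum_subtractf sum_distrib_left mult.assoc)
  ultimately have "(\<Sum>j\<in>J. b j * w j) \<le> (\<Sum>j\<in>J. (b j)\<^sup>2)"
    by linarith
  then show ?thesis
    using bw by (simp add: b_def power2_eq_square)
qed

section \<open>Factorizations of almost regular four-cycle free matrices\<close>

text \<open>The term \<open>j = l\<close> equals 1. Any other codegree lies in [0, 1], so its square
  is at most itself, and the remaining sum counts paths from \<open>l\<close> through a row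
  \<open>i\<close> to \<open>j\<close> with weight \<open>1 / (c j * c l)\<close>. If row
  \<open>i\<close> has \<open>r\<close> ones, then \<open>1 / c j \<le> \<rho> / r\<close>, so the
  paths through it contribute at most \<open>\<rho> / c l\<close>; there are \<open>c l\<close> such
  rows.\<close>

lemma codegree_weight_bound:
  fixes M :: "'i \<Rightarrow> 'j \<Rightarrow> real"
  assumes fin: "finite I" "finite J"
    and M01: "\<And>i j. i \<in> I \<Longrightarrow> j \<in> J \<Longrightarrow> M i j \<in> {0, 1}"
    and codeg: "\<And>j l. j \<in> J \<Longrightarrow> l \<in> J \<Longrightarrow> j \<noteq> l \<Longrightarrow> (\<Sum>i\<in>I. M i j * M i l) \<le> 1"
    and c: "\<And>j. j \<in> J \<Longrightarrow> c j = (\<Sum>i\<in>I. M i j)" "\<And>j. j \<in> J \<Longrightarrow> c j > 0"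
    and ratio: "\<And>i j. i \<in> I \<Longrightarrow> j \<in> J \<Longrightarrow> (\<Sum>k\<in>J. M i k) \<le> \<rho> * c j"
    and l: "l \<in> J"
  shows "(\<Sum>j\<in>J. (\<Sum>i\<in>I. M i j * M i l)\<^sup>2 / (c j * c l)) \<le> 1 + \<rho>"
proof -
  have M0: "0 \<le> M i j" if "i \<in> I" "j \<in> J" for i j
    using M01[OF that] by auto
  have sq: "M i j * M i j = M i j" if "i \<in> I" "j \<in> J" for i j
    using M01[OF that] by auto
  have diag: "(\<Sum>i\<in>I. M i l * M i l) = c l"
    by (simp add: c(1)[OF l] sq l)
  have "(\<Sum>j\<in>J - {l}. (\<Sum>i\<in>I. M i j * M i l)\<^sup>2 / (c j * c l)) \<le>
      (\<Sum>j\<in>J - {l}. \<Sum>i\<in>I. M i j * M i l / (c j * c l))"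
  proof (intro sum_mono)
    fix j assume j: "j \<in> J - {l}"
    have "0 \<le> (\<Sum>i\<in>I. M i j * M i l)"
      using M0 j l by (intro sum_nonneg mult_nonneg_nonneg) auto
    then have "(\<Sum>i\<in>I. M i j * M i l)\<^sup>2 \<le> (\<Sum>i\<in>I. M i j * M i l)"
      using codeg[of j l] j l by (simp add: power2_eq_square mult_left_le)
    then show "(\<Sum>i\<in>I. M i j * M i l)\<^sup>2 / (c j * c l) \<le> (\<Sum>i\<in>I. M i j * M i l / (c j * c l))"
      using c(2)[of j] c(2)[of l] j l
      by (simp add: divide_right_mono flip: sum_divide_distrib)
  qed
  \<comment> \<open>The nonnegative term \<open>j = l\<close> is put back so that full row sums
    appear.\<close>
  also have "\<dots> \<le> (\<Sum>j\<in>J. \<Sum>i\<in>I. M i j * M i l / (c j * c l))"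
    using M0 l c(2) fin by (intro sum_mono2 sum_nonneg) (auto simp: less_imp_le)
  also have "\<dots> = (\<Sum>i\<in>I. M i l / c l * (\<Sum>j\<in>J. M i j / c j))"
    by (subst sum.swap) (simp add: sum_distrib_left mult_ac)
  also have "\<dots> \<le> (\<Sum>i\<in>I. M i l / c l * \<rho>)"
  proof (intro sum_mono mult_left_mono)
    fix i assume i: "i \<in> I"
    define r where "r = (\<Sum>k\<in>J. M i k)"
    have r0: "0 \<le> r" unfolding r_def using M0 i by (intro sum_nonneg) auto
    show "(\<Sum>j\<in>J. M i j / c j) \<le> \<rho>"
    proof (cases "r = 0")
      case True
      then have "\<forall>j\<in>J. M i j = 0"
        using M0 i fin by (simp add: r_def sum_nonneg_eq_0_iff)
      moreover have "0 \<le> \<rho>"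
        using ratio[OF i l] c(2)[OF l] True by (simp add: r_def zero_le_mult_iff)
      ultimately show ?thesis by simp
    next
      case False
      have "(\<Sum>j\<in>J. M i j / c j) \<le> (\<Sum>j\<in>J. M i j * (\<rho> / r))"
      proof (intro sum_mono)
        fix j assume j: "j \<in> J"
        have "1 / c j \<le> \<rho> / r"
          using ratio[OF i j] c(2)[OF j] False r0 by (simp add: r_def[symmetric] field_simps)
        from mult_left_mono[OF this M0[OF i j]]
        show "M i j / c j \<le> M i j * (\<rho> / r)" by simp
      qed
      also have "\<dots> = \<rho>"
        using False unfolding sum_distrib_right[symmetric] r_def[symmetric] by simp
      finally show ?thesis .
    qed
    show "0 \<le> M i l / c l"
      using M0[OF i l] c(2)[OF l] by simp
  qed
  also have "\<dots> = \<rho>"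
    using c(1)[OF l] c(2)[OF l] by (simp flip: sum_distrib_right sum_divide_distrib)
  finally have "(\<Sum>j\<in>J - {l}. (\<Sum>i\<in>I. M i j * M i l)\<^sup>2 / (c j * c l)) \<le> \<rho>" .
  moreover have "(\<Sum>i\<in>I. M i l * M i l)\<^sup>2 / (c l * c l) = 1"
    using c(2)[OF l] by (simp add: diag power2_eq_square)
  ultimately show ?thesis
    using fin l by (simp add: sum.remove[of J l])
qed

text \<open>A duality argument. The test matrix with entries \<open>sqrt (c j) * Z i j\<close> has
  correlation at least \<open>e / 12\<close> with \<open>M\<close>. Inserting the factorization and
  applying Cauchy-Schwarz bounds the square of this correlation by
  \<open>(card I * A / 4) * (e * B)\<close>; cancelling \<open>e\<close> gives the claim.\<close>

lemma factorization_lower_bound: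
  fixes M :: "'i \<Rightarrow> 'j \<Rightarrow> real" and u :: "'i \<Rightarrow> 'k \<Rightarrow> real" and v :: "'k \<Rightarrow> 'j \<Rightarrow> real"
  assumes fin: "finite I" "finite J" and J_ne: "J \<noteq> {}"
    and M01: "\<And>i j. i \<in> I \<Longrightarrow> j \<in> J \<Longrightarrow> M i j \<in> {0, 1}"
    and codeg: "\<And>j l. j \<in> J \<Longrightarrow> l \<in> J \<Longrightarrow> j \<noteq> l \<Longrightarrow> (\<Sum>i\<in>I. M i j * M i l) \<le> 1"
    and c_pos: "\<And>j. j \<in> J \<Longrightarrow> (\<Sum>i\<in>I. M i j) > 0"
    and ratio: "\<And>i j. i \<in> I \<Longrightarrow> j \<in> J \<Longrightarrow> (\<Sum>k\<in>J. M i k) \<le> 16 * (\<Sum>i\<in>I. M i j)"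
    and fac: "\<And>i j. i \<in> I \<Longrightarrow> j \<in> J \<Longrightarrow> (\<Sum>k\<in>K. u i k * v k j) = M i j"
    and u: "\<And>i. i \<in> I \<Longrightarrow> (\<Sum>k\<in>K. (u i k)\<^sup>2) \<le> A"
    and v: "\<And>j. j \<in> J \<Longrightarrow> (\<Sum>k\<in>K. (v k j)\<^sup>2) \<le> B"
  shows "(\<Sum>i\<in>I. \<Sum>j\<in>J. M i j) \<le> 36 * real (card I) * (A * B)"
proof -
  define c where "c j = (\<Sum>i\<in>I. M i j)" for j
  define e where "e = (\<Sum>j\<in>J. c j)"
  have c_pos: "c j > 0" if "j \<in> J" for j
    using c_pos[OF that] by (simp add: c_def)
  have e_eq: "(\<Sum>i\<in>I. \<Sum>j\<in>J. M i j) = e"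
    unfolding e_def c_def by (rule sum.swap)
  \<comment> \<open>The factor 6 makes the diagonal of \<open>G\<close> equal to 1/36, while
    \<open>ratio\<close> bounds that of \<open>G\<^sup>2\<close> by (1 + 16) / 36^2, which is less
    than half of it.\<close>
  define Y where "Y i j = M i j / (6 * sqrt (c j))" for i j
  \<comment> \<open>Row \<open>i\<close> of \<open>Z = Y (1 + G)\<^sup>-\<^sup>1\<close> solves the
    system whose right-hand side is row \<open>i\<close> of \<open>Y\<close>. This \<open>Z\<close>
    is the test matrix called \<open>W\<close> in the overview.\<close>
  have "\<forall>i. \<exists>w. \<forall>j\<in>J. w j + (\<Sum>i\<in>I. Y i j * (\<Sum>k\<in>J. Y i k * w k)) = Y i j"
    using regularized_gram_solvable[OF fin(1)] by blast
  then obtain Z where Z: "\<And>i j. j \<in> J \<Longrightarrow>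
      Z i j + (\<Sum>i'\<in>I. Y i' j * (\<Sum>k\<in>J. Y i' k * Z i k)) = Y i j"
    by metis
  \<comment> \<open>Superposing the rows of \<open>Z\<close> gives solutions for the right-hand side
    \<open>Y\<^sup>T x\<close> that are linear in \<open>x\<close> by construction. Linearity is
    what lets the factorization of \<open>M\<close> be substituted below.\<close>
  define T where "T x j = (\<Sum>i\<in>I. Z i j * x i)" for x j
  have T: "T x j + (\<Sum>i\<in>I. Y i j * (\<Sum>k\<in>J. Y i k * T x k)) = (\<Sum>i\<in>I. Y i j * x i)"
    if "j \<in> J" for x j
  proof -
    have "(\<Sum>i\<in>I. Y i j * (\<Sum>k\<in>J. Y i k * T x k)) =
        (\<Sum>i\<in>I. \<Sum>k\<in>J. \<Sum>i'\<in>I. Y i j * (Y i k * (Z i' k * x i')))"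
      by (simp add: T_def sum_distrib_left)
    also have "\<dots> = (\<Sum>i\<in>I. \<Sum>i'\<in>I. \<Sum>k\<in>J. Y i j * (Y i k * (Z i' k * x i')))"
      by (intro sum.cong refl sum.swap)
    also have "\<dots> = (\<Sum>i'\<in>I. \<Sum>i\<in>I. \<Sum>k\<in>J. Y i j * (Y i k * (Z i' k * x i')))"
      by (rule sum.swap)
    also have "\<dots> = (\<Sum>i'\<in>I. (\<Sum>i\<in>I. Y i j * (\<Sum>k\<in>J. Y i k * Z i' k)) * x i')"
      by (simp add: sum_distrib_left sum_distrib_right mult_ac)
    also have "\<dots> = (\<Sum>i'\<in>I. (Y i' j - Z i' j) * x i')"
    proof (intro sum.cong refl)
      fix i'
      have "(\<Sum>i\<in>I. Y i j * (\<Sum>k\<in>J. Y i k * Z i' k)) = Y i' j - Z i' j"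
        using Z[OF that, of i'] by linarith
      then show "(\<Sum>i\<in>I. Y i j * (\<Sum>k\<in>J. Y i k * Z i' k)) * x i' = (Y i' j - Z i' j) * x i'"
        by simp
    qed
    finally show ?thesis
      by (simp add: T_def algebra_simps sum_subtractf)
  qed
  have diag: "T (\<lambda>i. Y i l) l \<ge> 1 / 72" if l: "l \<in> J" for l
  proof -
    have "(\<Sum>j\<in>J. (\<Sum>i\<in>I. Y i j * Y i l)\<^sup>2) =
        (\<Sum>j\<in>J. (\<Sum>i\<in>I. M i j * M i l)\<^sup>2 / (c j * c l)) / 1296"
      unfolding sum_divide_distrib
    proof (intro sum.cong refl)
      fix j assume j: "j \<in> J"
      have "(\<Sum>i\<in>I. Y i j * Y i l) = (\<Sum>i\<in>I. M i j * M i l) / (36 * (sqrt (c j) * sqrt (c l)))"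
        by (simp add: Y_def sum_divide_distrib)
      then show "(\<Sum>i\<in>I. Y i j * Y i l)\<^sup>2 = (\<Sum>i\<in>I. M i j * M i l)\<^sup>2 / (c j * c l) / 1296"
        using c_pos[OF j] c_pos[OF l] by (simp add: power_divide power_mult_distrib)
    qed
    also have "\<dots> \<le> 17 / 1296"
    proof -
      have "(\<Sum>j\<in>J. (\<Sum>i\<in>I. M i j * M i l)\<^sup>2 / (c j * c l)) \<le> 1 + 16"
        by (rule codegree_weight_bound[OF fin M01 codeg c_def c_pos _ l])
          (simp_all add: ratio c_def)
      then show ?thesis by simp
    qed
    finally have "(\<Sum>j\<in>J. (\<Sum>i\<in>I. Y i j * Y i l)\<^sup>2) \<le> 17 / 1296" .
    moreover have "(\<Sum>i\<in>I. (Y i l)\<^sup>2) = 1 / 36"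
    proof -
      have "(\<Sum>i\<in>I. (Y i l)\<^sup>2) = (\<Sum>i\<in>I. M i l / (36 * c l))"
      proof (intro sum.cong refl)
        fix i assume "i \<in> I"
        then have "(M i l)\<^sup>2 = M i l"
          using M01[OF _ l] by force
        then show "(Y i l)\<^sup>2 = M i l / (36 * c l)"
          using c_pos[OF l] by (simp add: Y_def power_divide power_mult_distrib)
      qed
      also have "\<dots> = c l / (36 * c l)"
        by (simp add: c_def sum_divide_distrib)
      finally show ?thesis using c_pos[OF l] by simp
    qed
    ultimately show ?thesis
      using regularized_gram_diagonal[OF T l] by simp
  qed
  define W where "W k = T (\<lambda>i. u i k)" for k
  \<comment> \<open>The weight \<open>6 * c j\<close> turns \<open>Y\<close> back into
    \<open>M\<close>, since \<open>6 * c j * Y i j = sqrt (c j) * M i j\<close>.\<close>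
  have "e / 12 = (\<Sum>j\<in>J. 6 * c j * (1 / 72))"
    by (simp add: e_def sum_divide_distrib)
  also have "\<dots> \<le> (\<Sum>j\<in>J. 6 * c j * T (\<lambda>i. Y i j) j)"
    using diag c_pos by (intro sum_mono mult_left_mono) (auto simp: less_imp_le)
  also have "\<dots> = (\<Sum>j\<in>J. sqrt (c j) * (\<Sum>i\<in>I. Z i j * M i j))"
  proof (intro sum.cong refl)
    fix j assume j: "j \<in> J"
    have "6 * c j * Y i j = sqrt (c j) * M i j" for i
      using c_pos[OF j] by (simp add: Y_def field_simps flip: real_sqrt_mult)
    then show "6 * c j * T (\<lambda>i. Y i j) j = sqrt (c j) * (\<Sum>i\<in>I. Z i j * M i j)"
      by (simp add: T_def sum_distrib_left mult.left_commute[of _ "Z _ _"])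
  qed
  also have "\<dots> = (\<Sum>j\<in>J. sqrt (c j) * (\<Sum>i\<in>I. Z i j * (\<Sum>k\<in>K. u i k * v k j)))"
    by (simp add: fac)
  also have "\<dots> = (\<Sum>j\<in>J. \<Sum>k\<in>K. W k j * (sqrt (c j) * v k j))"
    unfolding W_def T_def sum_distrib_left sum_distrib_right
    by (intro sum.cong refl, subst sum.swap) (simp add: mult_ac)
  also have "\<dots> = (\<Sum>(j, k)\<in>J \<times> K. W k j * (sqrt (c j) * v k j))"
    by (rule sum.cartesian_product)
  finally have lower: "e / 12 \<le> (\<Sum>(j, k)\<in>J \<times> K. W k j * (sqrt (c j) * v k j))" .
  have e0: "0 \<le> e"
    unfolding e_def using c_pos by (intro sum_nonneg) (auto simp: less_imp_le)
  \<comment> \<open>The contraction is applied to each column of \<open>u\<close>; the squares of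
    \<open>u\<close> are then summed by rows, where \<open>A\<close> bounds them.\<close>
  have W: "(\<Sum>(j, k)\<in>J \<times> K. (W k j)\<^sup>2) \<le> real (card I) * A / 4"
  proof -
    have "4 * (\<Sum>(j, k)\<in>J \<times> K. (W k j)\<^sup>2) = (\<Sum>k\<in>K. 4 * (\<Sum>j\<in>J. (W k j)\<^sup>2))"
      unfolding sum.cartesian_product[symmetric] sum_distrib_left[symmetric]
      by (subst sum.swap) simp
    also have "\<dots> \<le> (\<Sum>k\<in>K. \<Sum>i\<in>I. (u i k)\<^sup>2)"
      unfolding W_def by (intro sum_mono regularized_gram_contraction[OF T])
    also have "\<dots> = (\<Sum>i\<in>I. \<Sum>k\<in>K. (u i k)\<^sup>2)"
      by (rule sum.swap)
    also have "\<dots> \<le> real (card I) * A"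
      using u by (intro sum_bounded_above)
    finally show ?thesis by simp
  qed
  have V: "(\<Sum>(j, k)\<in>J \<times> K. (sqrt (c j) * v k j)\<^sup>2) \<le> e * B"
  proof -
    have "(\<Sum>(j, k)\<in>J \<times> K. (sqrt (c j) * v k j)\<^sup>2) = (\<Sum>j\<in>J. c j * (\<Sum>k\<in>K. (v k j)\<^sup>2))"
      using c_pos unfolding sum.cartesian_product[symmetric] sum_distrib_left
      by (intro sum.cong refl) (auto simp: power_mult_distrib less_imp_le)
    also have "\<dots> \<le> (\<Sum>j\<in>J. c j * B)"
      using v c_pos by (intro sum_mono mult_left_mono) (auto simp: less_imp_le)
    finally show ?thesis by (simp add: e_def sum_distrib_right)
  qed
  have "(e / 12)\<^sup>2 \<le> (\<Sum>(j, k)\<in>J \<times> K. W k j * (sqrt (c j) * v k j))\<^sup>2"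
    using lower e0 by (intro power_mono) auto
  also have "\<dots> \<le> (\<Sum>(j, k)\<in>J \<times> K. (W k j)\<^sup>2) * (\<Sum>(j, k)\<in>J \<times> K. (sqrt (c j) * v k j)\<^sup>2)"
    using Cauchy_Schwarz_ineq_sum[of "\<lambda>(j, k). W k j" "\<lambda>(j, k). sqrt (c j) * v k j" "J \<times> K"]
    by (simp add: case_prod_beta)
  also have "\<dots> \<le> (real (card I) * A / 4) * (e * B)"
  proof (intro mult_mono W V)
    show "0 \<le> real (card I) * A / 4"
      using W by (rule order_trans[rotated]) (auto intro: sum_nonneg)
  qed (auto intro: sum_nonneg)
  finally have main: "e * e \<le> e * (36 * real (card I) * (A * B))"
    by (simp add: power2_eq_square field_simps)
  obtain j where "j \<in> J" using J_ne by auto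
  then have "e > 0"
    unfolding e_def using c_pos fin by (intro sum_pos) auto
  then show ?thesis
    using main by (simp add: e_eq)
qed

section \<open>Degenerate bipartite graphs\<close>

text \<open>Degeneracy at most \<open>d\<close> of a bipartite graph, phrased with vertex subsets so
  that vertices can be deleted without reindexing and the two sides exchanged.\<close>

definition sparse :: "('a \<Rightarrow> 'b \<Rightarrow> bool) \<Rightarrow> nat \<Rightarrow> 'a set \<Rightarrow> 'b set \<Rightarrow> bool" where
  "sparse E d I J \<longleftrightarrow> (\<forall>I' J'. I' \<subseteq> I \<longrightarrow> J' \<subseteq> J \<longrightarrow> I' \<noteq> {} \<longrightarrow> J' \<noteq> {} \<longrightarrow>
    (\<exists>i\<in>I'. card {j \<in> J'. E i j} \<le> d) \<or> (\<exists>j\<in>J'. card {i \<in> I'. E i j} \<le> d))"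

lemma sparse_subset: "sparse E d I J \<Longrightarrow> I' \<subseteq> I \<Longrightarrow> J' \<subseteq> J \<Longrightarrow> sparse E d I' J'"
  unfolding sparse_def by (meson subset_trans)

lemma sparse_swap: "sparse E d I J \<Longrightarrow> sparse (\<lambda>j i. E i j) d J I"
  unfolding sparse_def by meson

text \<open>\<open>P\<close> marks the edges charged to their row; all others are charged to their column.\<close>

lemma sparse_peeling:
  assumes "finite I" "finite J" "sparse E d I J"
  shows "\<exists>P. (\<forall>i\<in>I. card {j \<in> J. E i j \<and> P i j} \<le> d) \<and>
    (\<forall>j\<in>J. card {i \<in> I. E i j \<and> \<not> P i j} \<le> d)"
  using assms
proof (induction "card I + card J" arbitrary: I J rule: less_induct)
  case less
  consider "I = {} \<or> J = {}"
    | i0 where "i0 \<in> I" "card {j \<in> J. E i0 j} \<le> d"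
    | j0 where "j0 \<in> J" "card {i \<in> I. E i j0} \<le> d"
    using less.prems(3) unfolding sparse_def by blast
  then show ?case
  proof cases
    case 1
    then show ?thesis by (intro exI[of _ "\<lambda>_ _. True"]) auto
  next
    case 2
    then have "card (I - {i0}) < card I"
      using less.prems(1) by (intro psubset_card_mono) auto
    then obtain P where P: "\<forall>i\<in>I - {i0}. card {j \<in> J. E i j \<and> P i j} \<le> d"
        "\<forall>j\<in>J. card {i \<in> I - {i0}. E i j \<and> \<not> P i j} \<le> d"
      using less.hyps[of "I - {i0}" J] less.prems sparse_subset[of E d I J "I - {i0}" J] by auto
    \<comment> \<open>All edges of the deleted row are charged to it, so no column receives a
      further charge. The case of a deleted column is symmetric.\<close>
    have row: "card {j \<in> J. E i j \<and> (i = i0 \<or> P i j)} \<le> d" if "i \<in> I" for i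
      using P(1) 2(2) that by (cases "i = i0") auto
    have eq: "{i \<in> I. E i j \<and> \<not> (i = i0 \<or> P i j)} = {i \<in> I - {i0}. E i j \<and> \<not> P i j}" for j
      by blast
    show ?thesis
      by (intro exI[of _ "\<lambda>i j. i = i0 \<or> P i j"] conjI ballI) (simp_all only: row eq bspec[OF P(2)])
  next
    case 3
    then have "card (J - {j0}) < card J"
      using less.prems(2) by (intro psubset_card_mono) auto
    then obtain P where P: "\<forall>i\<in>I. card {j \<in> J - {j0}. E i j \<and> P i j} \<le> d"
        "\<forall>j\<in>J - {j0}. card {i \<in> I. E i j \<and> \<not> P i j} \<le> d"
      using less.hyps[of I "J - {j0}"] less.prems sparse_subset[of E d I J I "J - {j0}"] by auto
    have col: "card {i \<in> I. E i j \<and> \<not> (j \<noteq> j0 \<and> P i j)} \<le> d" if "j \<in> J" for j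
      using P(2) 3(2) that by (cases "j = j0") auto
    have eq: "{j \<in> J. E i j \<and> (j \<noteq> j0 \<and> P i j)} = {j \<in> J - {j0}. E i j \<and> P i j}" for i
      by blast
    show ?thesis
      by (intro exI[of _ "\<lambda>i j. j \<noteq> j0 \<and> P i j"] conjI ballI) (simp_all only: col eq bspec[OF P(1)])
  qed
qed

lemma of_bool_sum_card: "finite A \<Longrightarrow> (\<Sum>x\<in>A. of_bool (P x)) = real (card {x \<in> A. P x})"
  by (simp add: Int_def)

text \<open>Each edge is charged to exactly one of its endpoints, and each vertex is charged at most
  \<open>d\<close> times.\<close>

lemma sparse_edge_count:
  assumes fin: "finite I" "finite J" and sp: "sparse E d I J"
  shows "(\<Sum>i\<in>I. \<Sum>j\<in>J. of_bool (E i j)) \<le> real d * (real (card I) + real (card J))"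
proof -
  obtain P where P: "\<And>i. i \<in> I \<Longrightarrow> card {j \<in> J. E i j \<and> P i j} \<le> d"
      "\<And>j. j \<in> J \<Longrightarrow> card {i \<in> I. E i j \<and> \<not> P i j} \<le> d"
    using sparse_peeling[OF fin sp] by blast
  have "(\<Sum>i\<in>I. \<Sum>j\<in>J. of_bool (E i j)) =
      (\<Sum>i\<in>I. \<Sum>j\<in>J. of_bool (E i j \<and> P i j) + of_bool (E i j \<and> \<not> P i j) :: real)"
    by (intro sum.cong refl) auto
  also have "\<dots> = (\<Sum>i\<in>I. \<Sum>j\<in>J. of_bool (E i j \<and> P i j)) +
      (\<Sum>j\<in>J. \<Sum>i\<in>I. of_bool (E i j \<and> \<not> P i j))"
    unfolding sum.distrib by (subst sum.swap[of _ J I]) (rule refl)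
  also have "\<dots> \<le> real (card I) * real d + real (card J) * real d"
    using P fin by (intro add_mono sum_bounded_above) (simp_all only: of_bool_sum_card of_nat_le_iff)
  finally show ?thesis
    by (simp add: algebra_simps)
qed

text \<open>By the edge count the average row degree is at most \<open>2 * d\<close>, so at least
  half of the rows have degree at most \<open>4 * d\<close>. Light columns are discarded afterwards,
  with degrees counted in the remaining rows; this preserves the upper bound on row degrees and
  costs at most half of the ones.\<close>

lemma sparse_almost_regular:
  assumes fin: "finite I" "finite J" and sp: "sparse E d I J"
    and ne: "I \<noteq> {}" and d: "d > 0" and JI: "card J \<le> card I"
    and deg: "\<And>i. i \<in> I \<Longrightarrow> d \<le> card {j \<in> J. E i j}"
  obtains I' J' where "I' \<subseteq> I" "J' \<subseteq> J" "I' \<noteq> {}"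
    "\<And>i. i \<in> I' \<Longrightarrow> (\<Sum>j\<in>J'. of_bool (E i j)) \<le> 4 * real d"
    "\<And>j. j \<in> J' \<Longrightarrow> real d \<le> 4 * (\<Sum>i\<in>I'. of_bool (E i j))"
    "real d * real (card I') \<le> 2 * (\<Sum>i\<in>I'. \<Sum>j\<in>J'. of_bool (E i j))"
proof -
  define r :: "'a \<Rightarrow> real" where "r i = (\<Sum>j\<in>J. of_bool (E i j))" for i
  define I' where "I' = {i \<in> I. r i \<le> 4 * real d}"
  define c :: "'b \<Rightarrow> real" where "c j = (\<Sum>i\<in>I'. of_bool (E i j))" for j
  define J' where "J' = {j \<in> J. real d \<le> 4 * c j}"
  have sub: "I' \<subseteq> I" "J' \<subseteq> J" by (auto simp: I'_def J'_def)
  have r: "real d \<le> r i" if "i \<in> I" for i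
    unfolding r_def using deg[OF that] fin by (simp only: of_bool_sum_card of_nat_le_iff)
  \<comment> \<open>Markov's inequality for the heavy rows.\<close>
  have "real (card (I - I')) * (4 * real d) \<le> (\<Sum>i\<in>I - I'. r i)"
    by (intro sum_bounded_below) (auto simp: I'_def)
  also have "\<dots> \<le> (\<Sum>i\<in>I. r i)"
    using fin by (intro sum_mono2) (auto simp: r_def intro: sum_nonneg)
  also have "\<dots> \<le> real d * (real (card I) + real (card J))"
    unfolding r_def by (rule sparse_edge_count[OF fin sp])
  also have "\<dots> \<le> real d * (real (card I) + real (card I))"
    using JI by (intro mult_left_mono) auto
  finally have "real d * (2 * real (card (I - I'))) \<le> real d * real (card I)"
    by simp
  then have "2 * real (card (I - I')) \<le> real (card I)"
    using d by (subst (asm) mult_le_cancel_left_pos) auto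
  moreover have "real (card (I - I')) = real (card I) - real (card I')"
    using fin(1) sub(1) by (simp add: card_Diff_subset finite_subset card_mono of_nat_diff)
  ultimately have half: "real (card I) \<le> 2 * real (card I')"
    by linarith
  have "real d * real (card I') \<le> (\<Sum>i\<in>I'. r i)"
    using r sub sum_bounded_below[of I' "real d" r] by (auto simp: mult.commute)
  also have "\<dots> = (\<Sum>j\<in>J. c j)"
    unfolding r_def c_def by (rule sum.swap)
  also have "\<dots> = (\<Sum>j\<in>J'. c j) + (\<Sum>j\<in>J - J'. c j)"
    using sum.subset_diff[OF sub(2) fin(2), of c] by simp
  also have "(\<Sum>j\<in>J - J'. c j) \<le> real (card (J - J')) * (real d / 4)"
    by (intro sum_bounded_above) (auto simp: J'_def)
  \<comment> \<open>As \<open>card J \<le> card I \<le> 2 * card I'\<close>, the light columns carry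
    at most half of the guaranteed \<open>d * card I'\<close> ones.\<close>
  also have "\<dots> \<le> (2 * real (card I')) * (real d / 4)"
  proof (intro mult_right_mono)
    have "card (J - J') \<le> card J" using fin by (intro card_mono) auto
    then show "real (card (J - J')) \<le> 2 * real (card I')" using JI half by linarith
  qed auto
  finally have edges: "real d * real (card I') \<le> 2 * (\<Sum>j\<in>J'. c j)"
    by (simp add: mult.commute)
  show thesis
  proof
    show "I' \<subseteq> I" "J' \<subseteq> J" by fact+
    show "I' \<noteq> {}"
      using half ne fin by auto
    show "(\<Sum>j\<in>J'. of_bool (E i j)) \<le> 4 * real d" if "i \<in> I'" for i
    proof -
      have "(\<Sum>j\<in>J'. of_bool (E i j)) \<le> r i"
        unfolding r_def using fin sub by (intro sum_mono2) auto
      then show ?thesis using that by (simp add: I'_def)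
    qed
    show "real d \<le> 4 * (\<Sum>i\<in>I'. of_bool (E i j))" if "j \<in> J'" for j
      using that by (simp only: J'_def c_def mem_Collect_eq)
    show "real d * real (card I') \<le> 2 * (\<Sum>i\<in>I'. \<Sum>j\<in>J'. of_bool (E i j))"
    proof -
      have "(\<Sum>i\<in>I'. \<Sum>j\<in>J'. of_bool (E i j)) = (\<Sum>j\<in>J'. c j)"
        unfolding c_def by (rule sum.swap)
      then show ?thesis using edges by (simp only:)
    qed
  qed
qed

section \<open>Submatrices as pairs of index sets\<close>

lemma bij_betw_pick:
  assumes "finite S"
  shows "bij_betw (pick S) {..<card S} S"
proof -
  have inj: "inj_on (pick S) {..<card S}"
  proof (rule inj_onI)
    fix x y assume "x \<in> {..<card S}" "y \<in> {..<card S}" "pick S x = pick S y"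
    then show "x = y"
      \<comment> \<open>The index \<open>x\<close> is recovered from \<open>pick S x\<close> as the
        number of smaller elements of \<open>S\<close>.\<close>
      using card_pick_le[of x S] card_pick_le[of y S] by (metis lessThan_iff)
  qed
  moreover have "pick S ` {..<card S} \<subseteq> S"
    by (auto simp: pick_in_set_le)
  ultimately show ?thesis
    using assms by (auto simp: bij_betw_def card_image card_subset_eq)
qed

text \<open>The set selecting a submatrix may exceed the dimension or be infinite. As
  \<open>pick\<close> enumerates in increasing order, it lists the elements below \<open>n\<close>
  first.\<close>

lemma bij_betw_pick_restrict: "bij_betw (pick S) {..<card {i. i < n \<and> i \<in> S}} {i. i < n \<and> i \<in> S}"
  using bij_betw_pick[of "{i. i < n \<and> i \<in> S}"]
  by (subst bij_betw_cong[where g = "pick {i. i < n \<and> i \<in> S}"]) (auto simp: pick_reduce_set)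

lemma card_bij_betw_Collect:
  assumes "bij_betw f A B"
  shows "card {x \<in> A. P (f x)} = card {y \<in> B. P y}"
proof -
  have "bij_betw f {x \<in> A. P (f x)} {y \<in> B. P y}"
    using assms by (auto simp: bij_betw_def inj_on_def)
  then show ?thesis by (rule bij_betw_same_card)
qed

text \<open>Counts of ones are invariant under the enumeration by \<open>pick\<close>, and only the
  parts of \<open>I\<close> and \<open>J\<close> below the dimensions matter; these range over all
  subsets of the row and column indices.\<close>

lemma degenerate_iff_sparse:
  "degenerate d M \<longleftrightarrow> sparse (\<lambda>i j. M $$ (i, j) = 1) d {..<dim_row M} {..<dim_col M}"
proof -
  have key: "(\<exists>i<dim_row (submatrix M I J). row_ones (submatrix M I J) i \<le> d) \<longleftrightarrow>
        (\<exists>i\<in>I'. card {j \<in> J'. M $$ (i, j) = 1} \<le> d)"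
      "(\<exists>j<dim_col (submatrix M I J). col_ones (submatrix M I J) j \<le> d) \<longleftrightarrow>
        (\<exists>j\<in>J'. card {i \<in> I'. M $$ (i, j) = 1} \<le> d)"
    if I': "I' = {i. i < dim_row M \<and> i \<in> I}" and J': "J' = {j. j < dim_col M \<and> j \<in> J}" for I J I' J'
  proof -
    have bI: "bij_betw (pick I) {..<card I'} I'" and bJ: "bij_betw (pick J) {..<card J'} J'"
      unfolding I' J' by (rule bij_betw_pick_restrict)+
    let ?N = "submatrix M I J"
    have dims: "dim_row ?N = card I'" "dim_col ?N = card J'"
      by (simp_all add: dim_submatrix I' J')
    have idx: "?N $$ (i, j) = M $$ (pick I i, pick J j)" if "i < card I'" "j < card J'" for i j
      using that submatrix_index[of i M I j J] by (simp add: I' J')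
    have row: "row_ones ?N i = card {j \<in> J'. M $$ (pick I i, j) = 1}" if "i < card I'" for i
    proof -
      have "row_ones ?N i = card {j \<in> {..<card J'}. M $$ (pick I i, pick J j) = 1}"
        unfolding row_ones_def dims using idx[OF that] by (intro arg_cong[of _ _ card]) auto
      then show ?thesis
        using card_bij_betw_Collect[OF bJ, of "\<lambda>j. M $$ (pick I i, j) = 1"] by simp
    qed
    have col: "col_ones ?N j = card {i \<in> I'. M $$ (i, pick J j) = 1}" if "j < card J'" for j
    proof -
      have "col_ones ?N j = card {i \<in> {..<card I'}. M $$ (pick I i, pick J j) = 1}"
        unfolding col_ones_def dims using idx[OF _ that] by (intro arg_cong[of _ _ card]) auto
      then show ?thesis
        using card_bij_betw_Collect[OF bI, of "\<lambda>i. M $$ (i, pick J j) = 1"] by simp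
    qed
    have imI: "I' = pick I ` {..<card I'}" and imJ: "J' = pick J ` {..<card J'}"
      using bI bJ by (simp_all add: bij_betw_def)
    have "(\<exists>i<dim_row ?N. row_ones ?N i \<le> d) \<longleftrightarrow>
        (\<exists>i\<in>{..<card I'}. card {j \<in> J'. M $$ (pick I i, j) = 1} \<le> d)"
      using row by (auto simp: dims)
    also have "\<dots> \<longleftrightarrow> (\<exists>i\<in>pick I ` {..<card I'}. card {j \<in> J'. M $$ (i, j) = 1} \<le> d)"
      by blast
    finally show "(\<exists>i<dim_row ?N. row_ones ?N i \<le> d) \<longleftrightarrow>
        (\<exists>i\<in>I'. card {j \<in> J'. M $$ (i, j) = 1} \<le> d)"
      unfolding imI[symmetric] .
    have "(\<exists>j<dim_col ?N. col_ones ?N j \<le> d) \<longleftrightarrow>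
        (\<exists>j\<in>{..<card J'}. card {i \<in> I'. M $$ (i, pick J j) = 1} \<le> d)"
      using col by (auto simp: dims)
    also have "\<dots> \<longleftrightarrow> (\<exists>j\<in>pick J ` {..<card J'}. card {i \<in> I'. M $$ (i, j) = 1} \<le> d)"
      by blast
    finally show "(\<exists>j<dim_col ?N. col_ones ?N j \<le> d) \<longleftrightarrow>
        (\<exists>j\<in>J'. card {i \<in> I'. M $$ (i, j) = 1} \<le> d)"
      unfolding imJ[symmetric] .
  qed
  let ?Q = "\<lambda>I' J'. I' \<noteq> {} \<longrightarrow> J' \<noteq> {} \<longrightarrow>
    (\<exists>i\<in>I'. card {j \<in> J'. M $$ (i, j) = 1} \<le> d) \<or> (\<exists>j\<in>J'. card {i \<in> I'. M $$ (i, j) = 1} \<le> d)"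
  have "degenerate d M \<longleftrightarrow>
      (\<forall>I J. ?Q {i. i < dim_row M \<and> i \<in> I} {j. j < dim_col M \<and> j \<in> J})"
    unfolding degenerate_def Let_def key[OF refl refl]
    by (simp only: dim_submatrix card_gt_0_iff finite_Collect_conjI finite_Collect_less_nat simp_thms)
  also have "\<dots> \<longleftrightarrow> (\<forall>I' J'. I' \<subseteq> {..<dim_row M} \<longrightarrow> J' \<subseteq> {..<dim_col M} \<longrightarrow> ?Q I' J')"
    (is "?l \<longleftrightarrow> ?r")
  proof
    assume l: ?l
    show ?r
    proof (intro allI impI)
      fix I' J' assume sub: "I' \<subseteq> {..<dim_row M}" "J' \<subseteq> {..<dim_col M}"
      then have "{i. i < dim_row M \<and> i \<in> I'} = I'" "{j. j < dim_col M \<and> j \<in> J'} = J'"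
        by auto
      then show "I' \<noteq> {} \<Longrightarrow> J' \<noteq> {} \<Longrightarrow> (\<exists>i\<in>I'. card {j \<in> J'. M $$ (i, j) = 1} \<le> d) \<or>
          (\<exists>j\<in>J'. card {i \<in> I'. M $$ (i, j) = 1} \<le> d)"
        using l[rule_format, of I' J'] by simp
    qed
  next
    assume r: ?r
    show ?l
    proof (intro allI)
      fix I J
      show "?Q {i. i < dim_row M \<and> i \<in> I} {j. j < dim_col M \<and> j \<in> J}"
        by (rule r[THEN spec, THEN spec, THEN mp, THEN mp]) auto
    qed
  qed
  finally show ?thesis
    unfolding sparse_def .
qed

section \<open>Lower bounds from a minimum degree\<close>

text \<open>In the almost regular part, row degrees are at most \<open>4 * d\<close> and column
  degrees at least \<open>d / 4\<close>, whence the ratio 16. It has at least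
  \<open>d * card I' / 2\<close> ones, so the constant 36 doubles to 72.\<close>

lemma factorization_lower_bound_unbalanced:
  fixes u :: "'a \<Rightarrow> 'k \<Rightarrow> real" and v :: "'k \<Rightarrow> 'b \<Rightarrow> real"
  assumes fin: "finite I" "finite J" and sp: "sparse E d I J"
    and ne: "I \<noteq> {}" and d: "d > 0" and JI: "card J \<le> card I"
    and deg: "\<And>i. i \<in> I \<Longrightarrow> d \<le> card {j \<in> J. E i j}"
    and c4: "\<And>i i' j j'. \<lbrakk>i \<in> I; i' \<in> I; j \<in> J; j' \<in> J; E i j; E i j'; E i' j; E i' j'\<rbrakk>
      \<Longrightarrow> i = i' \<or> j = j'"
    and fac: "\<And>i j. i \<in> I \<Longrightarrow> j \<in> J \<Longrightarrow> (\<Sum>k\<in>K. u i k * v k j) = of_bool (E i j)"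
    and u: "\<And>i. i \<in> I \<Longrightarrow> (\<Sum>k\<in>K. (u i k)\<^sup>2) \<le> A"
    and v: "\<And>j. j \<in> J \<Longrightarrow> (\<Sum>k\<in>K. (v k j)\<^sup>2) \<le> B"
  shows "real d \<le> 72 * (A * B)"
proof -
  obtain I' J' where sub: "I' \<subseteq> I" "J' \<subseteq> J" and I'_ne: "I' \<noteq> {}"
    and row: "\<And>i. i \<in> I' \<Longrightarrow> (\<Sum>j\<in>J'. of_bool (E i j)) \<le> 4 * real d"
    and col: "\<And>j. j \<in> J' \<Longrightarrow> real d \<le> 4 * (\<Sum>i\<in>I'. of_bool (E i j))"
    and edges: "real d * real (card I') \<le> 2 * (\<Sum>i\<in>I'. \<Sum>j\<in>J'. of_bool (E i j))"
    using sparse_almost_regular[OF fin sp ne d JI deg] by metis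
  have fin': "finite I'" "finite J'"
    using fin sub finite_subset by blast+
  have card_pos: "0 < real (card I')"
    using fin' I'_ne by (simp add: card_gt_0_iff)
  have "(\<Sum>i\<in>I'. \<Sum>j\<in>J'. of_bool (E i j)) \<le> 36 * real (card I') * (A * B)"
  proof (rule factorization_lower_bound[where u = u and v = v and K = K])
    show "J' \<noteq> {}"
    proof
      assume "J' = {}"
      then have "real d * real (card I') \<le> 0" using edges by simp
      then show False using d card_pos by (simp add: mult_le_0_iff)
    qed
    show "(\<Sum>i\<in>I'. of_bool (E i j) * of_bool (E i l)) \<le> (1 :: real)"
      if "j \<in> J'" "l \<in> J'" "j \<noteq> l" for j l
    proof -
      have "card {i \<in> I'. E i j \<and> E i l} \<le> Suc 0"
      proof (subst card_le_Suc0_iff_eq, safe)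
        fix i i' assume "i \<in> I'" "i' \<in> I'" "E i j" "E i l" "E i' j" "E i' l"
        then show "i = i'"
          using c4[of i i' j l] that sub by blast
      qed (use fin' in simp)
      then have "real (card {i \<in> I'. E i j \<and> E i l}) \<le> 1" by simp
      moreover have "(\<Sum>i\<in>I'. of_bool (E i j) * of_bool (E i l)) =
          (\<Sum>i\<in>I'. of_bool (E i j \<and> E i l) :: real)"
        by (simp only: of_bool_conj)
      ultimately show ?thesis
        using fin' by (simp only: of_bool_sum_card)
    qed
    show "0 < (\<Sum>i\<in>I'. of_bool (E i j) :: real)" if "j \<in> J'" for j
    proof -
      have "0 < real d" using d by simp
      then show ?thesis using col[OF that] by linarith
    qed
    show "(\<Sum>k\<in>J'. of_bool (E i k)) \<le> 16 * (\<Sum>i\<in>I'. of_bool (E i j) :: real)"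
      if "i \<in> I'" "j \<in> J'" for i j
      using row[OF that(1)] col[OF that(2)] by linarith
  qed (use fin' subsetD[OF sub(1)] subsetD[OF sub(2)] in \<open>simp_all add: fac u v\<close>)
  with edges have "real (card I') * real d \<le> real (card I') * (72 * (A * B))"
    by (simp add: mult_ac)
  then show ?thesis
    using card_pos by (subst (asm) mult_le_cancel_left_pos)
qed

text \<open>If the columns are the larger side, transpose: the two factors exchange roles, and the
  bound is symmetric in \<open>A\<close> and \<open>B\<close>.\<close>

lemma factorization_lower_bound_min_degree:
  fixes u :: "'a \<Rightarrow> 'k \<Rightarrow> real" and v :: "'k \<Rightarrow> 'b \<Rightarrow> real"
  assumes fin: "finite I" "finite J" and sp: "sparse E d I J"
    and ne: "I \<noteq> {}" "J \<noteq> {}" and d: "d > 0"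
    and deg: "\<And>i. i \<in> I \<Longrightarrow> d \<le> card {j \<in> J. E i j}" "\<And>j. j \<in> J \<Longrightarrow> d \<le> card {i \<in> I. E i j}"
    and c4: "\<And>i i' j j'. \<lbrakk>i \<in> I; i' \<in> I; j \<in> J; j' \<in> J; E i j; E i j'; E i' j; E i' j'\<rbrakk>
      \<Longrightarrow> i = i' \<or> j = j'"
    and fac: "\<And>i j. i \<in> I \<Longrightarrow> j \<in> J \<Longrightarrow> (\<Sum>k\<in>K. u i k * v k j) = of_bool (E i j)"
    and u: "\<And>i. i \<in> I \<Longrightarrow> (\<Sum>k\<in>K. (u i k)\<^sup>2) \<le> A"
    and v: "\<And>j. j \<in> J \<Longrightarrow> (\<Sum>k\<in>K. (v k j)\<^sup>2) \<le> B"
  shows "real d \<le> 72 * (A * B)"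
proof (cases "card J \<le> card I")
  case True
  show ?thesis
    by (rule factorization_lower_bound_unbalanced[OF fin sp ne(1) d True deg(1) c4 fac u v])
next
  case False
  have "real d \<le> 72 * (B * A)"
  proof (rule factorization_lower_bound_unbalanced[OF fin(2,1) sparse_swap[OF sp] ne(2) d _ deg(2),
        where u = "\<lambda>j k. v k j" and v = "\<lambda>k i. u i k" and K = K])
    show "card I \<le> card J" using False by simp
    show "(\<Sum>k\<in>K. v k j * u i k) = of_bool (E i j)" if "j \<in> J" "i \<in> I" for i j
      using fac[OF that(2,1)] by (simp add: mult.commute)
    show "j = j' \<or> i = i'"
      if "j \<in> J" "j' \<in> J" "i \<in> I" "i' \<in> I" "E i j" "E i' j" "E i j'" "E i' j'" for i i' j j'
      using c4[OF that(3,4,1,2,5,7,6,8)] by auto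
  qed (use u v in auto)
  then show ?thesis by (simp add: mult.commute)
qed

section \<open>The factorization norm of a matrix\<close>

text \<open>The submatrix on \<open>{i, i'}\<close> and \<open>{j, j'}\<close> lists the indices in
  increasing order, but as all four entries are 1 it is all-ones whichever index comes
  first.\<close>

lemma four_cycle_freeD:
  assumes M: "four_cycle_free M"
    and ij: "i < dim_row M" "i' < dim_row M" "j < dim_col M" "j' < dim_col M"
    and ones: "M $$ (i, j) = 1" "M $$ (i, j') = 1" "M $$ (i', j) = 1" "M $$ (i', j') = 1"
  shows "i = i' \<or> j = j'"
proof (rule ccontr)
  assume neq: "\<not> (i = i' \<or> j = j')"
  have sets: "{a. a < dim_row M \<and> a \<in> {i, i'}} = {i, i'}" "{a. a < dim_col M \<and> a \<in> {j, j'}} = {j, j'}"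
    using ij by auto
  have cards: "card {i, i'} = 2" "card {j, j'} = 2"
    using neq by auto
  have "submatrix M {i, i'} {j, j'} = mat 2 2 (\<lambda>_. 1)"
  proof (rule eq_matI)
    fix a b assume "a < dim_row (mat 2 2 (\<lambda>_. 1 :: real))" "b < dim_col (mat 2 2 (\<lambda>_. 1 :: real))"
    then have ab: "a < 2" "b < 2" by auto
    then have "pick {i, i'} a \<in> {i, i'}" "pick {j, j'} b \<in> {j, j'}"
      by (simp_all only: pick_in_set_le cards)
    then have "M $$ (pick {i, i'} a, pick {j, j'} b) = 1"
      using ones by auto
    then show "submatrix M {i, i'} {j, j'} $$ (a, b) = mat 2 2 (\<lambda>_. 1) $$ (a, b)"
      using ab by (subst submatrix_index) (simp_all only: sets cards index_mat)
  qed (simp_all only: dim_submatrix sets cards dim_row_mat dim_col_mat)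
  then show False
    using M unfolding four_cycle_free_def by blast
qed

lemma boolean_mat_entry:
  assumes "boolean_mat M" "i < dim_row M" "j < dim_col M"
  shows "M $$ (i, j) = of_bool (M $$ (i, j) = 1)"
proof -
  have "M $$ (i, j) \<in> elements_mat M"
    using assms by (intro elements_matI[of M "dim_row M" "dim_col M"]) auto
  then show ?thesis
    using assms(1) unfolding boolean_mat_def by auto
qed

text \<open>The least value exists because no row has more than \<open>dim_col M\<close>
  ones.\<close>

lemma degenerate_degeneracy: "degenerate (degeneracy M) M"
proof -
  have "degenerate (dim_col M) M"
    unfolding degenerate_iff_sparse sparse_def
  proof (intro allI impI disjI1)
    fix I J assume "J \<subseteq> {..<dim_col M}" "I \<noteq> ({} :: nat set)"
    moreover have "card {j \<in> J. M $$ (i, j) = 1} \<le> dim_col M" if "J \<subseteq> {..<dim_col M}" for i J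
      using card_mono[of "{..<dim_col M}" "{j \<in> J. M $$ (i, j) = 1}"] that by auto
    ultimately show "\<exists>i\<in>I. card {j \<in> J. M $$ (i, j) = 1} \<le> dim_col M"
      by blast
  qed
  then show ?thesis
    unfolding degeneracy_def by (rule LeastI)
qed

text \<open>By minimality, degeneracy at most \<open>degeneracy M - 1\<close> fails. As the
  degeneracy is positive, exceeding \<open>degeneracy M - 1\<close> means reaching
  \<open>degeneracy M\<close>.\<close>

lemma degeneracy_core:
  assumes "degeneracy M > 0"
  shows "\<exists>I J. I \<subseteq> {..<dim_row M} \<and> J \<subseteq> {..<dim_col M} \<and> I \<noteq> {} \<and> J \<noteq> {} \<and>
    (\<forall>i\<in>I. degeneracy M \<le> card {j \<in> J. M $$ (i, j) = 1}) \<and>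
    (\<forall>j\<in>J. degeneracy M \<le> card {i \<in> I. M $$ (i, j) = 1})"
proof -
  have "\<not> degenerate (degeneracy M - 1) M"
    using assms not_less_Least[of "degeneracy M - 1" "\<lambda>d. degenerate d M"]
    unfolding degeneracy_def by simp
  moreover have "k \<le> degeneracy M - 1 \<longleftrightarrow> \<not> degeneracy M \<le> k" for k
    using assms by auto
  ultimately show ?thesis
    unfolding degenerate_iff_sparse sparse_def by simp
qed

section \<open>Row norms, column norms and their infimum\<close>

lemma row_norm_nonneg: "0 \<le> row_norm U"
  unfolding row_norm_def by (intro Max_ge) auto

lemma col_norm_nonneg: "0 \<le> col_norm V"
  unfolding col_norm_def by (intro Max_ge) auto

lemma row_sum_le_row_norm:
  assumes "i < dim_row U"
  shows "(\<Sum>k<dim_col U. (U $$ (i, k))\<^sup>2) \<le> (row_norm U)\<^sup>2"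
proof -
  have "sqrt (\<Sum>k<dim_col U. (U $$ (i, k))\<^sup>2) \<le> row_norm U"
    using assms unfolding row_norm_def L2_set_def[symmetric] by (intro Max_ge) auto
  then show ?thesis
    by (rule sqrt_le_D)
qed

lemma col_sum_le_col_norm:
  assumes "j < dim_col V"
  shows "(\<Sum>k<dim_row V. (V $$ (k, j))\<^sup>2) \<le> (col_norm V)\<^sup>2"
proof -
  have "sqrt (\<Sum>k<dim_row V. (V $$ (k, j))\<^sup>2) \<le> col_norm V"
    using assms unfolding col_norm_def L2_set_def[symmetric] by (intro Max_ge) auto
  then show ?thesis
    by (rule sqrt_le_D)
qed

lemma row_norm_le:
  assumes "0 \<le> a" "\<And>i. i < dim_row U \<Longrightarrow> (\<Sum>k<dim_col U. (U $$ (i, k))\<^sup>2) \<le> a"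
  shows "row_norm U \<le> sqrt a"
  using assms unfolding row_norm_def L2_set_def by (subst Max_le_iff) auto

lemma col_norm_le:
  assumes "0 \<le> a" "\<And>j. j < dim_col V \<Longrightarrow> (\<Sum>k<dim_row V. (V $$ (k, j))\<^sup>2) \<le> a"
  shows "col_norm V \<le> sqrt a"
  using assms unfolding col_norm_def L2_set_def by (subst Max_le_iff) auto

lemma mult_mat_entry:
  assumes "dim_col U = dim_row V" "i < dim_row U" "j < dim_col V"
  shows "(U * V) $$ (i, j) = (\<Sum>k<dim_row V. U $$ (i, k) * V $$ (k, j))"
  using assms by (simp add: scalar_prod_def lessThan_atLeast0)

lemma gamma2_le_row_norm_col_norm:
  assumes "dim_col U = dim_row V" "U * V = M"
  shows "gamma2 M \<le> row_norm U * col_norm V"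
proof -
  have "row_norm U * col_norm V \<in> factorization_values M"
    using assms unfolding factorization_values_def by blast
  then show ?thesis
    unfolding gamma2_def using factorization_values_nonneg
    by (intro cInf_lower bdd_belowI[of _ 0])
qed

lemma le_gamma2:
  assumes "\<And>x. x \<in> factorization_values M \<Longrightarrow> a \<le> x"
  shows "a \<le> gamma2 M"
  unfolding gamma2_def using assms factorization_values_nonempty by (intro cInf_greatest)

text \<open>The core has minimum degree \<open>d\<close> and inherits \<open>sparse\<close> at the
  same level \<open>d\<close>; restricting a factorization of \<open>M\<close> to it does not
  increase the norms of rows and columns.\<close>

lemma gamma2_ge_sqrt_degeneracy:
  assumes bool: "boolean_mat M" and free: "four_cycle_free M"
  shows "sqrt (real (degeneracy M)) / 9 \<le> gamma2 M"
proof (cases "degeneracy M = 0")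
  case True
  then show ?thesis
    using factorization_values_nonneg by (intro le_gamma2) auto
next
  case False
  define d where "d = degeneracy M"
  have d: "d > 0" using False by (simp add: d_def)
  obtain I J where sub: "I \<subseteq> {..<dim_row M}" "J \<subseteq> {..<dim_col M}" and ne: "I \<noteq> {}" "J \<noteq> {}"
    and deg: "\<forall>i\<in>I. d \<le> card {j \<in> J. M $$ (i, j) = 1}" "\<forall>j\<in>J. d \<le> card {i \<in> I. M $$ (i, j) = 1}"
    using degeneracy_core[of M, folded d_def, OF d] by auto
  have fin: "finite I" "finite J"
    using sub finite_subset by blast+
  have sp: "sparse (\<lambda>i j. M $$ (i, j) = 1) d I J"
    using degenerate_degeneracy[of M] sub unfolding degenerate_iff_sparse d_def
    by (rule sparse_subset)
  show ?thesis
  proof (rule le_gamma2)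
    fix x assume "x \<in> factorization_values M"
    then obtain U V where x: "x = row_norm U * col_norm V"
      and dims: "dim_col U = dim_row V" and UV: "U * V = M"
      unfolding factorization_values_def by blast
    have rows: "dim_row U = dim_row M" and cols: "dim_col V = dim_col M"
      using UV by auto
    have "real d \<le> 72 * ((row_norm U)\<^sup>2 * (col_norm V)\<^sup>2)"
    proof (rule factorization_lower_bound_min_degree[OF fin sp ne d bspec[OF deg(1)] bspec[OF deg(2)],
          where u = "\<lambda>i k. U $$ (i, k)" and v = "\<lambda>k j. V $$ (k, j)" and K = "{..<dim_row V}"])
      show "(\<Sum>k<dim_row V. U $$ (i, k) * V $$ (k, j)) = of_bool (M $$ (i, j) = 1)"
        if "i \<in> I" "j \<in> J" for i j
      proof -
        have ij: "i < dim_row M" "j < dim_col M" using that sub by auto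
        then have "(\<Sum>k<dim_row V. U $$ (i, k) * V $$ (k, j)) = M $$ (i, j)"
          using mult_mat_entry[OF dims, of i j] by (simp add: rows cols UV)
        also have "\<dots> = of_bool (M $$ (i, j) = 1)"
          by (rule boolean_mat_entry[OF bool ij])
        finally show ?thesis .
      qed
      show "i = i' \<or> j = j'" if "i \<in> I" "i' \<in> I" "j \<in> J" "j' \<in> J" "M $$ (i, j) = 1"
          "M $$ (i, j') = 1" "M $$ (i', j) = 1" "M $$ (i', j') = 1" for i i' j j'
        using that(1-4) sub by (intro four_cycle_freeD[OF free _ _ _ _ that(5-8)]) auto
      show "(\<Sum>k<dim_row V. (U $$ (i, k))\<^sup>2) \<le> (row_norm U)\<^sup>2" if "i \<in> I" for i
        using row_sum_le_row_norm[of i U] that sub rows dims by auto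
      show "(\<Sum>k<dim_row V. (V $$ (k, j))\<^sup>2) \<le> (col_norm V)\<^sup>2" if "j \<in> J" for j
        using col_sum_le_col_norm[of j V] that sub cols by auto
    qed
    \<comment> \<open>72 is rounded up to the square 81.\<close>
    also have "\<dots> \<le> (9 * x)\<^sup>2"
      by (simp add: x power_mult_distrib mult_right_mono)
    finally have "sqrt (real d) \<le> 9 * x"
      using row_norm_nonneg[of U] col_norm_nonneg[of V] by (intro real_le_lsqrt) (auto simp: x)
    then show "sqrt (real (degeneracy M)) / 9 \<le> x"
      by (simp add: d_def)
  qed
qed

section \<open>The upper bound by peeling\<close>

lemma sum_lessThan_add:
  fixes f :: "nat \<Rightarrow> real"
  shows "(\<Sum>k<n + m. f k) = (\<Sum>k<n. f k) + (\<Sum>k<m. f (n + k))"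
  by (induction m) (simp_all add: add.assoc)

text \<open>With \<open>M = A + B\<close> from the peeling and \<open>t = sqrt s\<close>, take the
  block matrices \<open>U = [A / t, t I]\<close> and \<open>V = [t I; B / t]\<close>. Rows of
  \<open>A\<close> and columns of \<open>B\<close> have at most \<open>d\<close> ones, so each
  squared row norm of \<open>U\<close> and column norm of \<open>V\<close> is at most
  \<open>d / s + s\<close>.\<close>

lemma gamma2_le_degenerate:
  assumes bool: "boolean_mat M" and dg: "degenerate d M" and s: "s > 0"
  shows "gamma2 M \<le> real d / s + s"
proof -
  define m n where "m = dim_row M" and "n = dim_col M"
  define E where "E i j \<longleftrightarrow> M $$ (i, j) = 1" for i j
  obtain P where P: "\<forall>i\<in>{..<m}. card {j \<in> {..<n}. E i j \<and> P i j} \<le> d"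
    "\<forall>j\<in>{..<n}. card {i \<in> {..<m}. E i j \<and> \<not> P i j} \<le> d"
    using sparse_peeling[of "{..<m}" "{..<n}" E d] dg
    unfolding degenerate_iff_sparse m_def n_def E_def by blast
  define t where "t = sqrt s"
  have t: "t > 0" "t\<^sup>2 = s"
    using s by (simp_all add: t_def)
  define U where "U = mat m (n + m)
    (\<lambda>(i, k). if k < n then of_bool (E i k \<and> P i k) / t else t * of_bool (k - n = i))"
  define V where "V = mat (n + m) n
    (\<lambda>(k, j). if k < n then t * of_bool (k = j) else of_bool (E (k - n) j \<and> \<not> P (k - n) j) / t)"
  have "U * V = M"
  proof (rule eq_matI)
    fix i j assume "i < dim_row M" "j < dim_col M"
    then have ij: "i < m" "j < n" by (simp_all add: m_def n_def)
    have "(U * V) $$ (i, j) = (\<Sum>k<n + m. U $$ (i, k) * V $$ (k, j))"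
      using ij by (subst mult_mat_entry) (simp_all add: U_def V_def)
    also have "\<dots> = (\<Sum>k<n. of_bool (E i k \<and> P i k) * of_bool (k = j)) +
        (\<Sum>k<m. of_bool (k = i) * of_bool (E k j \<and> \<not> P k j))"
      unfolding sum_lessThan_add using ij t(1)
      by (intro arg_cong2[of _ _ _ _ "(+)"] sum.cong refl) (simp_all add: U_def V_def)
    also have "(\<Sum>k<n. of_bool (E i k \<and> P i k) * of_bool (k = j)) = (of_bool (E i j \<and> P i j) :: real)"
      using ij by (subst sum.remove[of _ j]) (auto intro!: sum.neutral)
    also have "(\<Sum>k<m. of_bool (k = i) * of_bool (E k j \<and> \<not> P k j)) =
        (of_bool (E i j \<and> \<not> P i j) :: real)"
      using ij by (subst sum.remove[of _ i]) (auto intro!: sum.neutral)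
    also have "of_bool (E i j \<and> P i j) + of_bool (E i j \<and> \<not> P i j) = (of_bool (E i j) :: real)"
      by auto
    also have "\<dots> = M $$ (i, j)"
      using boolean_mat_entry[OF bool, of i j] ij by (simp add: E_def m_def n_def)
    finally show "(U * V) $$ (i, j) = M $$ (i, j)" .
  qed (simp_all add: U_def V_def m_def n_def)
  then have "gamma2 M \<le> row_norm U * col_norm V"
    by (intro gamma2_le_row_norm_col_norm) (simp add: U_def V_def)
  also have "\<dots> \<le> sqrt (real d / s + s) * sqrt (real d / s + s)"
  proof (intro mult_mono row_norm_le col_norm_le)
    show "(\<Sum>k<dim_col U. (U $$ (i, k))\<^sup>2) \<le> real d / s + s" if "i < dim_row U" for i
    proof -
      have i: "i < m" using that by (simp add: U_def)
      have "(\<Sum>k<dim_col U. (U $$ (i, k))\<^sup>2) =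
          (\<Sum>k<n. of_bool (E i k \<and> P i k) / s) + (\<Sum>k<m. s * of_bool (k = i))"
        unfolding U_def dim_col_mat sum_lessThan_add using i
        by (intro arg_cong2[of _ _ _ _ "(+)"] sum.cong refl)
          (auto simp: power_divide power_mult_distrib t)
      also have "(\<Sum>k<n. of_bool (E i k \<and> P i k) / s) = real (card {j \<in> {..<n}. E i j \<and> P i j}) / s"
        unfolding sum_divide_distrib[symmetric] by (subst of_bool_sum_card) auto
      also have "\<dots> \<le> real d / s"
        using P(1) i s by (intro divide_right_mono) auto
      also have "(\<Sum>k<m. s * of_bool (k = i)) = s"
        using i by (subst sum.remove[of _ i]) (auto intro!: sum.neutral)
      finally show ?thesis by simp
    qed
    show "(\<Sum>k<dim_row V. (V $$ (k, j))\<^sup>2) \<le> real d / s + s" if "j < dim_col V" for j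
    proof -
      have j: "j < n" using that by (simp add: V_def)
      have "(\<Sum>k<dim_row V. (V $$ (k, j))\<^sup>2) =
          (\<Sum>k<n. s * of_bool (k = j)) + (\<Sum>k<m. of_bool (E k j \<and> \<not> P k j) / s)"
        unfolding V_def dim_row_mat sum_lessThan_add using j
        by (intro arg_cong2[of _ _ _ _ "(+)"] sum.cong refl)
          (auto simp: power_divide power_mult_distrib t)
      also have "(\<Sum>k<m. of_bool (E k j \<and> \<not> P k j) / s) =
          real (card {i \<in> {..<m}. E i j \<and> \<not> P i j}) / s"
        unfolding sum_divide_distrib[symmetric] by (subst of_bool_sum_card) auto
      also have "\<dots> \<le> real d / s"
        using P(2) j s by (intro divide_right_mono) auto
      also have "(\<Sum>k<n. s * of_bool (k = j)) = s"
        using j by (subst sum.remove[of _ j]) (auto intro!: sum.neutral)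
      finally show ?thesis by simp
    qed
  qed (use s in \<open>simp_all add: col_norm_nonneg\<close>)
  also have "\<dots> = real d / s + s"
    using s by simp
  finally show ?thesis .
qed

text \<open>The scale \<open>s = sqrt d\<close> balances the two summands. It is not positive for
  \<open>d = 0\<close>, where \<open>s\<close> tends to 0 instead.\<close>

lemma gamma2_le_sqrt_degenerate:
  assumes "boolean_mat M" "degenerate d M"
  shows "gamma2 M \<le> 2 * sqrt (real d)"
proof (cases "d = 0")
  case True
  have "gamma2 M \<le> 0 + s" if "s > 0" for s
    using gamma2_le_degenerate[OF assms that] True by simp
  then have "gamma2 M \<le> 0"
    by (rule field_le_epsilon)
  then show ?thesis using True by simp
next
  case False
  then show ?thesis
    using gamma2_le_degenerate[OF assms, of "sqrt (real d)"] by (simp add: real_div_sqrt)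
qed

theorem theorem1p4:
  shows "\<exists>c C :: real. c > 0 \<and> C > 0 \<and>
    (\<forall>(M :: real mat) (d :: nat).
       boolean_mat M \<longrightarrow> four_cycle_free M \<longrightarrow> degeneracy M = d \<longrightarrow>
       c * sqrt (real d) \<le> gamma2 M \<and> gamma2 M \<le> C * sqrt (real d))"
proof (intro exI conjI allI impI)
  fix M :: "real mat" and d
  assume M: "boolean_mat M" "four_cycle_free M" "degeneracy M = d"
  show "(1 / 9) * sqrt (real d) \<le> gamma2 M"
    using gamma2_ge_sqrt_degeneracy[OF M(1,2)] M(3) by simp
  show "gamma2 M \<le> 2 * sqrt (real d)"
    using gamma2_le_sqrt_degenerate[OF M(1) degenerate_degeneracy] M(3) by simp
qed simp_all

end
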